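(* Let $n,s\in\mathbb{N}$, $c,\check c\in\mathbb{C}^n$ and $\hat c=H_s(\check c)$. Then, for any $1\leq p\leq\infty$, $$ \|c-\hat c\|_p\leq3\|c-\check c\|_p+3\sigma_s(c)_p. $$
   Context: $H_s:\mathbb{C}^n\to\mathbb{C}^n$ is the hard-thresholding operator: $H_s(z)$ keeps the $s$ largest entries of $z$ in absolute value (ties broken by any fixed rule) and sets all other entries to zero. A vector is $s$-sparse if it has at most $s$ nonzero entries, and $\sigma_s(c)_p=\inf\{\|c-z\|_p: z\in\mathbb{C}^n \text{ is } s\text{-sparse}\}$. *)

theory Defs
  imports "HOL-Analysis.Analysis"
begin

definition lp_norm :: "ennreal \<Rightarrow> complex ^ 'n \<Rightarrow> real" where
  "lp_norm p x =
     (if p = \<infinity> then Max (range (\<lambda>i. cmod (x $ i)))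
      else (\<Sum>i\<in>UNIV. cmod (x $ i) powr enn2real p) powr (1 / enn2real p))"

definition sparse :: "nat \<Rightarrow> complex ^ 'n \<Rightarrow> bool" where
  "sparse s z \<longleftrightarrow> card {i. z $ i \<noteq> 0} \<le> s"

definition sigma_err :: "nat \<Rightarrow> ennreal \<Rightarrow> complex ^ 'n \<Rightarrow> real" where
  "sigma_err s p c = (INF z\<in>{z. sparse s z}. lp_norm p (c - z))"

text \<open>
  The operator depends on how ties are broken, so it is specified rather than constructed: the
  functions satisfying this predicate are exactly the operators obtained from the possible
  tie-breaking rules. The minimum makes the operator the identity when s is at least the dimension.
\<close>

definition hard_thresholding :: "nat \<Rightarrow> (complex ^ 'n \<Rightarrow> complex ^ 'n) \<Rightarrow> bool" where
  "hard_thresholding s H \<longleftrightarrow>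
     (\<forall>z. \<exists>S. card S = min s CARD('n) \<and>
           (\<forall>i\<in>S. \<forall>j\<in>-S. cmod (z $ j) \<le> cmod (z $ i)) \<and>
           H z = (\<chi> i. if i \<in> S then z $ i else 0))"

lemma hard_thresholding_exists: "\<exists>H :: complex ^ 'n \<Rightarrow> complex ^ 'n. hard_thresholding s H"
proof -
  have "\<exists>S :: 'n set. card S = min k CARD('n) \<and> (\<forall>i\<in>S. \<forall>j\<in>-S. cmod (z $ j) \<le> cmod (z $ i))"
    for z :: "complex ^ 'n" and k
  proof (induction k)
    case 0
    show ?case by (rule exI[of _ "{}"]) simp
  next
    case (Suc k)
    then obtain S :: "'n set" where S: "card S = min k CARD('n)"
      "\<And>i j. i \<in> S \<Longrightarrow> j \<notin> S \<Longrightarrow> cmod (z $ j) \<le> cmod (z $ i)" by auto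
    show ?case
    proof (cases "S = UNIV")
      case True
      with S(1) have "CARD('n) \<le> k" by simp
      then show ?thesis by (intro exI[of _ UNIV]) simp
    next
      case False
      have "card S < CARD('n)"
        using False by (simp add: psubset_card_mono psubset_eq)
      with S(1) have k: "card S = k" "k < CARD('n)" by auto
      obtain m where m: "m \<in> -S" "\<And>j. j \<in> -S \<Longrightarrow> cmod (z $ j) \<le> cmod (z $ m)"
      proof -
        let ?M = "(\<lambda>j. cmod (z $ j)) ` (-S)"
        have "Max ?M \<in> ?M" using False by (intro Max_in) auto
        then obtain m where "m \<in> -S" "Max ?M = cmod (z $ m)" by blast
        moreover have "cmod (z $ j) \<le> Max ?M" if "j \<in> -S" for j
          using that by (intro Max_ge) auto
        ultimately show thesis using that by metis
      qed
      show ?thesis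
        using S(2) m k by (intro exI[of _ "insert m S"]) auto
    qed
  qed
  then have "\<forall>z :: complex ^ 'n. \<exists>y. \<exists>S. card S = min s CARD('n) \<and>
      (\<forall>i\<in>S. \<forall>j\<in>-S. cmod (z $ j) \<le> cmod (z $ i)) \<and> y = (\<chi> i. if i \<in> S then z $ i else 0)"
    by blast
  then show ?thesis
    unfolding hard_thresholding_def by (rule choice)
qed

end

theory Submission
  imports Defs
begin

text \<open>
  Thresholding is a best \<open>s\<close>-term approximation in every \<open>\<ell>\<^sup>p\<close> norm: the entries that it
  discards are, counted without repetition, no larger than the entries that any other
  \<open>s\<close>-sparse vector \<open>z\<close> fails to match (\<open>hard_thresholding_best_approx\<close>).  Approximating
  \<open>c_check\<close> by \<open>H c_check\<close> is therefore at least as good as approximating it by a sparse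
  approximation \<open>z\<close> of \<open>c\<close>, and two uses of the triangle inequality give
  \<open>\<parallel>c - H c_check\<parallel> \<le> \<parallel>c - c_check\<parallel> + \<parallel>c_check - z\<parallel> \<le> 2 \<parallel>c - c_check\<parallel> + \<parallel>c - z\<parallel>\<close>.
  Taking the infimum over \<open>z\<close> yields the estimate, with the constants 2 and 1 in place of 3.
  The triangle inequality for finite \<open>p\<close> is Minkowski's inequality, which is derived from the
  convexity of \<open>t \<mapsto> t\<^sup>p\<close>.
\<close>

lemma powr_convex_combination_le:
  fixes q u v l m :: real
  assumes "q \<ge> 1" "u \<ge> 0" "v \<ge> 0" "l \<ge> 0" "m \<ge> 0" "l + m = 1"
  shows "(l * u + m * v) powr q \<le> l * u powr q + m * v powr q"
proof -
  \<comment> \<open>At the boundary of the half-line convexity reduces to \<open>t\<^sup>q \<le> t\<close> on the unit interval.\<close>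
  have scale: "(t * w) powr q \<le> t * w powr q" if "0 \<le> t" "t \<le> 1" "0 \<le> w" for t w :: real
  proof -
    have "t powr q \<le> t"
      using powr_mono'[of 1 q t] that assms(1) by simp
    then show ?thesis
      using that by (simp add: powr_mult mult_right_mono)
  qed
  consider "u = 0" | "v = 0" | "u > 0" "v > 0" using assms by linarith
  then show ?thesis
  proof cases
    case 1
    then show ?thesis using scale[of m v] assms by simp
  next
    case 2
    then show ?thesis using scale[of l u] assms by simp
  next
    case 3
    then show ?thesis
      using convex_onD[OF powr_convex[OF assms(1)], of m u v] assms
      by (simp add: eq_diff_eq[symmetric])
  qed
qed

text \<open>
  If \<open>a\<close> and \<open>b\<close> are the norms of \<open>f\<close> and \<open>g\<close>, then \<open>f + g\<close> is \<open>a + b\<close> times a convex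
  combination of two unit vectors.  The convexity of \<open>t \<mapsto> t\<^sup>q\<close>, applied to each entry and summed,
  shows that such a combination has norm at most 1.
\<close>

lemma Minkowski_sum_powr:
  fixes f g :: "'a \<Rightarrow> real" and q :: real
  assumes A: "finite A" and q: "q \<ge> 1"
    and f: "\<And>i. i \<in> A \<Longrightarrow> f i \<ge> 0" and g: "\<And>i. i \<in> A \<Longrightarrow> g i \<ge> 0"
  shows "(\<Sum>i\<in>A. (f i + g i) powr q) powr (1 / q)
    \<le> (\<Sum>i\<in>A. f i powr q) powr (1 / q) + (\<Sum>i\<in>A. g i powr q) powr (1 / q)"
proof -
  define a where "a = (\<Sum>i\<in>A. f i powr q) powr (1 / q)"
  define b where "b = (\<Sum>i\<in>A. g i powr q) powr (1 / q)"
  have aq: "a powr q = (\<Sum>i\<in>A. f i powr q)" and bq: "b powr q = (\<Sum>i\<in>A. g i powr q)"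
    using q by (simp_all add: a_def b_def powr_powr sum_nonneg)
  consider "a = 0" | "b = 0" | "a > 0" "b > 0"
    unfolding a_def b_def by (metis powr_gt_zero powr_eq_0_iff)
  then have "(\<Sum>i\<in>A. (f i + g i) powr q) powr (1 / q) \<le> a + b"
  proof cases
    case 1
    then have "\<forall>i\<in>A. f i = 0"
      using aq A by (simp add: sum_nonneg_eq_0_iff)
    then show ?thesis using 1 by (simp add: b_def)
  next
    case 2
    then have "\<forall>i\<in>A. g i = 0"
      using bq A by (simp add: sum_nonneg_eq_0_iff)
    then show ?thesis using 2 by (simp add: a_def)
  next
    case 3
    define l m where "l = a / (a + b)" and "m = b / (a + b)"
    have lm: "l \<ge> 0" "m \<ge> 0" "l + m = 1"
      using 3 by (auto simp: l_def m_def add_divide_distrib[symmetric])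
    have entry: "(f i + g i) powr q
        \<le> (a + b) powr q * (l * (f i powr q / a powr q) + m * (g i powr q / b powr q))"
      if "i \<in> A" for i
    proof -
      have "f i + g i = (a + b) * (l * (f i / a) + m * (g i / b))"
        using 3 by (simp add: l_def m_def add_divide_distrib[symmetric])
      then have "(f i + g i) powr q
          = (a + b) powr q * (l * (f i / a) + m * (g i / b)) powr q"
        using 3 lm f[OF that] g[OF that] by (simp add: powr_mult)
      also have "\<dots> \<le> (a + b) powr q * (l * (f i / a) powr q + m * (g i / b) powr q)"
        using 3 lm f[OF that] g[OF that] q
        by (intro mult_left_mono powr_convex_combination_le) auto
      finally show ?thesis
        using 3 f[OF that] g[OF that] by (simp add: powr_divide)
    qed
    have "(\<Sum>i\<in>A. (f i + g i) powr q)
        \<le> (\<Sum>i\<in>A. (a + b) powr q * (l * (f i powr q / a powr q) + m * (g i powr q / b powr q)))"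
      by (intro sum_mono entry)
    also have "\<dots> = (a + b) powr q * (l * ((\<Sum>i\<in>A. f i powr q) / a powr q)
        + m * ((\<Sum>i\<in>A. g i powr q) / b powr q))"
      by (simp add: sum_distrib_left[symmetric] sum.distrib sum_divide_distrib[symmetric])
    also have "\<dots> = (a + b) powr q"
      using 3 lm by (simp add: aq[symmetric] bq[symmetric])
    finally have "(\<Sum>i\<in>A. (f i + g i) powr q) powr (1 / q) \<le> ((a + b) powr q) powr (1 / q)"
      using q by (intro powr_mono2) (auto intro: sum_nonneg)
    also have "\<dots> = a + b"
      using q 3 by (simp add: powr_powr)
    finally show ?thesis .
  qed
  then show ?thesis by (simp add: a_def b_def)
qed

text \<open>
  The norm depends only on the multiset of absolute values and is monotone in it, so entries may be
  compared after moving them to other positions.  Injectivity ensures that no entry of \<open>y\<close> is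
  counted twice.
\<close>

lemma lp_norm_le_rearrange:
  fixes x y :: "complex ^ 'n" and h :: "'n \<Rightarrow> 'n"
  assumes inj: "inj_on h A"
    and le: "\<And>i. i \<in> A \<Longrightarrow> cmod (x $ i) \<le> cmod (y $ h i)"
    and zero: "\<And>i. i \<notin> A \<Longrightarrow> x $ i = 0"
  shows "lp_norm p x \<le> lp_norm p y"
proof (cases "p = \<infinity>")
  case True
  have "cmod (x $ i) \<le> Max (range (\<lambda>j. cmod (y $ j)))" for i
  proof -
    have "cmod (x $ i) \<le> cmod (y $ (if i \<in> A then h i else i))"
      using le zero by auto
    also have "\<dots> \<le> Max (range (\<lambda>j. cmod (y $ j)))"
      by (intro Max_ge) auto
    finally show ?thesis .
  qed
  then show ?thesis using True by (auto simp: lp_norm_def)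
next
  case False
  define q where "q = enn2real p"
  have q: "q \<ge> 0" by (simp add: q_def)
  have "(\<Sum>i\<in>UNIV. cmod (x $ i) powr q) = (\<Sum>i\<in>A. cmod (x $ i) powr q)"
    using zero by (intro sum.mono_neutral_right) auto
  also have "\<dots> \<le> (\<Sum>i\<in>A. cmod (y $ h i) powr q)"
    using le q by (intro sum_mono powr_mono2) auto
  also have "\<dots> = (\<Sum>j\<in>h ` A. cmod (y $ j) powr q)"
    using inj by (simp add: sum.reindex)
  also have "\<dots> \<le> (\<Sum>j\<in>UNIV. cmod (y $ j) powr q)"
    by (intro sum_mono2) auto
  finally show ?thesis
    using False q unfolding lp_norm_def q_def[symmetric]
    by (auto intro!: powr_mono2 sum_nonneg)
qed

lemma lp_norm_nonneg: "lp_norm p (x :: complex ^ 'n) \<ge> 0"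
proof -
  have "cmod (x $ undefined) \<le> Max (range (\<lambda>i. cmod (x $ i)))"
    by (intro Max_ge) auto
  then have "0 \<le> Max (range (\<lambda>i. cmod (x $ i)))"
    by (rule order_trans[OF norm_ge_zero])
  then show ?thesis by (simp add: lp_norm_def)
qed

lemma lp_norm_minus_commute: "lp_norm p (x - y) = lp_norm p (y - x)"
  by (simp add: lp_norm_def norm_minus_commute)

lemma lp_norm_triangle_ineq:
  fixes x y :: "complex ^ 'n"
  assumes "1 \<le> p"
  shows "lp_norm p (x + y) \<le> lp_norm p x + lp_norm p y"
proof (cases "p = \<infinity>")
  case True
  have "cmod (x $ i + y $ i)
      \<le> Max (range (\<lambda>j. cmod (x $ j))) + Max (range (\<lambda>j. cmod (y $ j)))" for i
    by (rule order_trans[OF norm_triangle_ineq]) (intro add_mono Max_ge, auto)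
  then show ?thesis using True by (auto simp: lp_norm_def)
next
  case False
  define q where "q = enn2real p"
  have q: "q \<ge> 1"
    using enn2real_mono[OF assms] False by (simp add: q_def less_top)
  have "(\<Sum>i\<in>UNIV. cmod (x $ i + y $ i) powr q) powr (1 / q)
      \<le> (\<Sum>i\<in>UNIV. (cmod (x $ i) + cmod (y $ i)) powr q) powr (1 / q)"
    using q by (intro powr_mono2 sum_mono sum_nonneg norm_triangle_ineq) auto
  also have "\<dots> \<le> (\<Sum>i\<in>UNIV. cmod (x $ i) powr q) powr (1 / q)
      + (\<Sum>i\<in>UNIV. cmod (y $ i) powr q) powr (1 / q)"
    using q by (intro Minkowski_sum_powr) auto
  finally show ?thesis
    using False by (simp add: lp_norm_def q_def)
qed

text \<open>
  Let \<open>S\<close> be the set of kept indices and \<open>T\<close> the support of \<open>z\<close>.  Outside \<open>S \<union> T\<close> both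
  approximations miss the entry of \<open>y\<close> completely.  Since \<open>card T \<le> card S\<close>, the indices in
  \<open>T - S\<close> can be sent injectively into \<open>S - T\<close>, where the entries of \<open>y\<close> are at least as
  large and are all missed by \<open>z\<close>.
\<close>

lemma hard_thresholding_best_approx:
  fixes y z :: "complex ^ 'n"
  assumes H: "hard_thresholding s H" and z: "sparse s z"
  shows "lp_norm p (y - H y) \<le> lp_norm p (y - z)"
proof -
  obtain S where S: "card S = min s CARD('n)"
      "\<And>i j. i \<in> S \<Longrightarrow> j \<notin> S \<Longrightarrow> cmod (y $ j) \<le> cmod (y $ i)"
      "H y = (\<chi> i. if i \<in> S then y $ i else 0)"
    using H unfolding hard_thresholding_def by (metis Compl_iff)
  define T where "T = {i. z $ i \<noteq> 0}"
  have "card T \<le> card S"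
    using z S(1) by (simp add: T_def sparse_def card_mono)
  then have "card (T - S) \<le> card (S - T)"
    by (intro card_le_sym_Diff) auto
  then obtain g where g: "g ` (T - S) \<subseteq> S - T" "inj_on g (T - S)"
    using card_le_inj[of "T - S" "S - T"] by auto
  let ?h = "\<lambda>i. if i \<in> T then g i else i"
  show ?thesis
  proof (rule lp_norm_le_rearrange[where h = ?h and A = "- S"])
    show "inj_on ?h (- S)"
      using g by (auto simp: inj_on_def)
  next
    fix i assume i: "i \<in> - S"
    then have "?h i \<notin> T" "cmod (y $ i) \<le> cmod (y $ ?h i)"
      using g(1) S(2) by auto
    then show "cmod ((y - H y) $ i) \<le> cmod ((y - z) $ ?h i)"
      using i by (simp add: S(3) T_def)
  next
    fix i assume "i \<notin> - S"
    then show "(y - H y) $ i = 0" by (simp add: S(3))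
  qed
qed

lemma sigma_err_greatest:
  assumes "\<And>z. sparse s z \<Longrightarrow> b \<le> lp_norm p (c - z)"
  shows "b \<le> sigma_err s p c"
proof -
  have "sparse s 0" by (simp add: sparse_def)
  then show ?thesis
    unfolding sigma_err_def using assms by (intro cINF_greatest) auto
qed

theorem lemma2p4:
  fixes s :: nat and p :: ennreal
    and H :: "complex ^ 'n \<Rightarrow> complex ^ 'n"
    and c c_check c_hat :: "complex ^ 'n"
  assumes "hard_thresholding s H"
    and "c_hat = H c_check"
    and "1 \<le> p"
  shows "lp_norm p (c - c_hat) \<le> 3 * lp_norm p (c - c_check) + 3 * sigma_err s p c"
proof -
  have triangle: "lp_norm p (u - w) \<le> lp_norm p (u - v) + lp_norm p (v - w)"
    for u v w :: "complex ^ 'n"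
    using lp_norm_triangle_ineq[OF assms(3), of "u - v" "v - w"] by simp
  have "lp_norm p (c - c_hat) - 2 * lp_norm p (c - c_check) \<le> sigma_err s p c"
  proof (rule sigma_err_greatest)
    fix z :: "complex ^ 'n" assume z: "sparse s z"
    have "lp_norm p (c - c_hat) \<le> lp_norm p (c - c_check) + lp_norm p (c_check - c_hat)"
      by (rule triangle)
    also have "lp_norm p (c_check - c_hat) \<le> lp_norm p (c_check - z)"
      unfolding assms(2) by (rule hard_thresholding_best_approx[OF assms(1) z])
    also have "\<dots> \<le> lp_norm p (c - c_check) + lp_norm p (c - z)"
      using triangle[of c_check z c] by (simp add: lp_norm_minus_commute)
    finally show "lp_norm p (c - c_hat) - 2 * lp_norm p (c - c_check) \<le> lp_norm p (c - z)"
      by simp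
  qed
  moreover have "0 \<le> sigma_err s p c"
    by (intro sigma_err_greatest lp_norm_nonneg)
  ultimately show ?thesis
    using lp_norm_nonneg[of p "c - c_check"] by linarith
qed

end
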